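(* Let $L$ be a congruence splitting lattice. Then the semilattice $\operatorname{Con_c} L$ of compact congruences of $L$ satisfies the Uniform Refinement Property.
   Context: Semilattices are join-semilattices (not necessarily bounded); the join operation is written $+$ and $\le$ denotes the associated order. For a lattice $L$, $\operatorname{Con_c} L$ is the join-semilattice of compact (i.e. finitely generated) congruences of $L$, and for $u,v\in L$, $\Theta(u,v)$ is the least congruence of $L$ identifying $u$ and $v$. A lattice $L$ is *congruence splitting* if for all $a\le b$ in $L$ and all congruences $\alpha_0,\alpha_1$ of $L$ such that $\Theta(a,b)\subseteq\alpha_0\vee\alpha_1$, there are elements $x_0,x_1$ of $[a,b]$ such that $x_0\vee x_1=b$ and $\Theta(a,x_i)\subseteq\alpha_i$ for all $i<2$. Let $S$ be a semilattice and $e\in S$. The *Uniform Refinement Property holds at $e$* if for all families $(a_i)_{i\in I}$ and $(b_i)_{i\in I}$ of elements of $S$ (with arbitrary index set $I$) such that $a_i+b_i=e$ for all $i\in I$, there are families $(a_i^* )_{i\in I}$, $(b_i^* )_{i\in I}$ and $(c_{ij})_{(i,j)\in I\times I}$ of elements of $S$ such that: (i) for all $i\in I$, $a_i^*\le a_i$, $b_i^*\le b_i$ and $a_i^*+b_i^*=e$; (ii) for all $i,j\in I$, $c_{ij}\le a_i^*$, $c_{ij}\le b_j^*$ and $a_i^*\le a_j^*+c_{ij}$; (iii) for all $i,j,k\in I$, $c_{ik}\le c_{ij}+c_{jk}$. The semilattice $S$ *satisfies the Uniform Refinement Property* if the property holds at every element of $S$. *)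

theory Defs
  imports Main
begin

definition lattice_congruence :: "('a::lattice \<times> 'a) set \<Rightarrow> bool" where
  "lattice_congruence r \<longleftrightarrow> equiv UNIV r \<and>
     (\<forall>x y x' y'. (x, y) \<in> r \<longrightarrow> (x', y') \<in> r \<longrightarrow>
        (sup x x', sup y y') \<in> r \<and> (inf x x', inf y y') \<in> r)"

lemma lattice_congruence_Inter:
  assumes "\<And>r. r \<in> R \<Longrightarrow> lattice_congruence r"
  shows "lattice_congruence (\<Inter>R)"
proof -
  have 1: "equiv UNIV (\<Inter>R)"
  proof (rule equivI)
    show "refl (\<Inter>R)"
      using assms unfolding lattice_congruence_def equiv_def refl_on_def by blast
    show "sym (\<Inter>R)"
      using assms unfolding lattice_congruence_def equiv_def sym_def by blast
    show "trans (\<Inter>R)"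
      using assms unfolding lattice_congruence_def equiv_def trans_def by blast
  qed auto
  show ?thesis
    unfolding lattice_congruence_def
    using 1 assms unfolding lattice_congruence_def by (intro conjI allI impI) blast+
qed

text \<open>The congruence lattice \<open>Con L\<close> of a lattice \<open>L\<close> (the type \<open>'a\<close>), ordered by inclusion of
  relations.\<close>

typedef (overloaded) 'a congruence = "{r :: ('a::lattice \<times> 'a) set. lattice_congruence r}"
  morphisms rel_of Congruence
proof
  show "UNIV \<in> {r :: ('a \<times> 'a) set. lattice_congruence r}"
    using lattice_congruence_Inter[of "{}"] by simp
qed

lemma lattice_congruence_rel_of: "lattice_congruence (rel_of \<alpha>)"
  using rel_of[of \<alpha>] by simp

instantiation congruence :: (lattice) complete_lattice
begin

definition less_eq_congruence :: "'a congruence \<Rightarrow> 'a congruence \<Rightarrow> bool" where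
  "\<alpha> \<le> \<beta> \<longleftrightarrow> rel_of \<alpha> \<subseteq> rel_of \<beta>"

definition less_congruence :: "'a congruence \<Rightarrow> 'a congruence \<Rightarrow> bool" where
  "\<alpha> < \<beta> \<longleftrightarrow> rel_of \<alpha> \<subset> rel_of \<beta>"

definition Inf_congruence :: "'a congruence set \<Rightarrow> 'a congruence" where
  "Inf A = Congruence (\<Inter>\<alpha>\<in>A. rel_of \<alpha>)"

definition Sup_congruence :: "'a congruence set \<Rightarrow> 'a congruence" where
  "Sup (A :: 'a congruence set) = Inf {\<gamma>. \<forall>\<alpha>\<in>A. \<alpha> \<le> \<gamma>}"

definition inf_congruence :: "'a congruence \<Rightarrow> 'a congruence \<Rightarrow> 'a congruence" where
  "inf (\<alpha> :: 'a congruence) \<beta> = Inf {\<alpha>, \<beta>}"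

definition sup_congruence :: "'a congruence \<Rightarrow> 'a congruence \<Rightarrow> 'a congruence" where
  "sup (\<alpha> :: 'a congruence) \<beta> = Sup {\<alpha>, \<beta>}"

definition top_congruence :: "'a congruence" where
  "(top :: 'a congruence) = Inf {}"

definition bot_congruence :: "'a congruence" where
  "(bot :: 'a congruence) = Sup {}"

lemma rel_of_Inf: "rel_of (Inf A) = (\<Inter>\<alpha>\<in>A. rel_of \<alpha>)"
proof -
  have "lattice_congruence (\<Inter>\<alpha>\<in>A. rel_of \<alpha>)"
    by (rule lattice_congruence_Inter) (auto simp: lattice_congruence_rel_of)
  then show ?thesis
    by (simp add: Inf_congruence_def Congruence_inverse)
qed

instance
proof
  fix \<alpha> \<beta> \<gamma> :: "'a congruence" and A :: "'a congruence set"
  show "\<alpha> < \<beta> \<longleftrightarrow> \<alpha> \<le> \<beta> \<and> \<not> \<beta> \<le> \<alpha>"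
    by (auto simp: less_eq_congruence_def less_congruence_def)
  show "\<alpha> \<le> \<alpha>" "\<alpha> \<le> \<beta> \<Longrightarrow> \<beta> \<le> \<gamma> \<Longrightarrow> \<alpha> \<le> \<gamma>"
    by (auto simp: less_eq_congruence_def)
  show "\<alpha> \<le> \<beta> \<Longrightarrow> \<beta> \<le> \<alpha> \<Longrightarrow> \<alpha> = \<beta>"
    by (simp add: less_eq_congruence_def flip: rel_of_inject)
qed (auto simp: less_eq_congruence_def inf_congruence_def sup_congruence_def
      top_congruence_def bot_congruence_def Sup_congruence_def rel_of_Inf)

end

definition congruence_generated :: "('a::lattice \<times> 'a) set \<Rightarrow> 'a congruence" where
  "congruence_generated X = Inf {\<alpha>. X \<subseteq> rel_of \<alpha>}"

definition Theta :: "'a::lattice \<Rightarrow> 'a \<Rightarrow> 'a congruence" where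
  "Theta u v = congruence_generated {(u, v)}"

lemma congruence_generated_le_iff: "congruence_generated X \<le> \<alpha> \<longleftrightarrow> X \<subseteq> rel_of \<alpha>"
  by (auto simp: congruence_generated_def less_eq_congruence_def rel_of_Inf)

lemma Theta_le_iff: "Theta u v \<le> \<alpha> \<longleftrightarrow> (u, v) \<in> rel_of \<alpha>"
  by (simp add: Theta_def congruence_generated_le_iff)

definition congruence_splitting :: "'a::lattice itself \<Rightarrow> bool" where
  "congruence_splitting (_ :: 'a itself) \<longleftrightarrow>
     (\<forall>(a::'a) b (\<alpha>\<^sub>0 :: 'a congruence) \<alpha>\<^sub>1.
        a \<le> b \<longrightarrow> Theta a b \<le> sup \<alpha>\<^sub>0 \<alpha>\<^sub>1 \<longrightarrow>
        (\<exists>x\<^sub>0\<in>{a..b}. \<exists>x\<^sub>1\<in>{a..b}.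
           sup x\<^sub>0 x\<^sub>1 = b \<and> Theta a x\<^sub>0 \<le> \<alpha>\<^sub>0 \<and> Theta a x\<^sub>1 \<le> \<alpha>\<^sub>1))"

definition compact_element :: "'c::complete_lattice \<Rightarrow> bool" where
  "compact_element x \<longleftrightarrow> (\<forall>A. x \<le> Sup A \<longrightarrow> (\<exists>F. finite F \<and> F \<subseteq> A \<and> x \<le> Sup F))"

lemma compact_element_bot: "compact_element bot"
  unfolding compact_element_def by (metis bot_least empty_subsetI finite.emptyI)

lemma compact_element_sup:
  assumes "compact_element x" "compact_element y"
  shows "compact_element (sup x y)"
  unfolding compact_element_def
proof (intro allI impI)
  fix A assume "sup x y \<le> Sup A"
  then obtain F G where "finite F" "F \<subseteq> A" "x \<le> Sup F" "finite G" "G \<subseteq> A" "y \<le> Sup G"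
    using assms unfolding compact_element_def by (metis le_sup_iff)
  then show "\<exists>F. finite F \<and> F \<subseteq> A \<and> sup x y \<le> Sup F"
    by (intro exI[of _ "F \<union> G"]) (auto simp: Sup_union_distrib intro: le_supI1 le_supI2)
qed

text \<open>Compact congruences are the finitely generated ones.\<close>

lemma rel_of_Sup_finitary:
  "rel_of (Sup A) = (\<Union>F\<in>{F. finite F \<and> F \<subseteq> A}. rel_of (Sup F :: 'a::lattice congruence))"
    (is "_ = ?r")
proof
  have mono: "rel_of (Sup F) \<subseteq> rel_of (Sup G)" if "F \<subseteq> G" for F G :: "'a congruence set"
    using Sup_subset_mono[OF that] by (simp add: less_eq_congruence_def)
  show "?r \<subseteq> rel_of (Sup A)"
    using mono by blast
  have cong: "equiv UNIV (rel_of \<beta>)"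
    "(x, y) \<in> rel_of \<beta> \<Longrightarrow> (x', y') \<in> rel_of \<beta> \<Longrightarrow>
       (sup x x', sup y y') \<in> rel_of \<beta> \<and> (inf x x', inf y y') \<in> rel_of \<beta>"
    for \<beta> :: "'a congruence" and x y x' y'
    using lattice_congruence_rel_of[of \<beta>] unfolding lattice_congruence_def by blast+
  have join: "\<exists>H. finite H \<and> H \<subseteq> A \<and> p \<in> rel_of (Sup H) \<and> q \<in> rel_of (Sup H)"
    if "p \<in> ?r" "q \<in> ?r" for p q
  proof -
    obtain F G where FG: "finite F" "F \<subseteq> A" "p \<in> rel_of (Sup F)" "finite G" "G \<subseteq> A"
      "q \<in> rel_of (Sup G)"
      using \<open>p \<in> ?r\<close> \<open>q \<in> ?r\<close> by blast
    then show ?thesis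
      using mono[of F "F \<union> G"] mono[of G "F \<union> G"] by (intro exI[of _ "F \<union> G"]) auto
  qed
  have "equiv UNIV ?r"
  proof (rule equivI)
    show "refl ?r"
      using cong(1)[of "Sup {}"] by (force simp: equiv_def refl_on_def)
    show "sym ?r"
      using cong(1) unfolding equiv_def sym_def by blast
    show "trans ?r"
    proof (rule transI)
      fix x y z assume "(x, y) \<in> ?r" "(y, z) \<in> ?r"
      then obtain H where H: "finite H" "H \<subseteq> A" "(x, y) \<in> rel_of (Sup H)" "(y, z) \<in> rel_of (Sup H)"
        using join by meson
      then have "(x, z) \<in> rel_of (Sup H)"
        using cong(1)[of "Sup H"] unfolding equiv_def by (meson transE)
      with H show "(x, z) \<in> ?r" by blast
    qed
  qed auto
  moreover have "(sup x x', sup y y') \<in> ?r \<and> (inf x x', inf y y') \<in> ?r"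
    if xy: "(x, y) \<in> ?r" "(x', y') \<in> ?r" for x y x' y'
  proof -
    obtain H where H: "finite H" "H \<subseteq> A" "(x, y) \<in> rel_of (Sup H)" "(x', y') \<in> rel_of (Sup H)"
      using join[OF xy] by blast
    with cong(2)[OF H(3,4)] show ?thesis by blast
  qed
  ultimately have "lattice_congruence ?r"
    unfolding lattice_congruence_def by blast
  then have *: "rel_of (Congruence ?r) = ?r"
    by (simp add: Congruence_inverse)
  have "Sup A \<le> Congruence ?r"
  proof (rule Sup_least)
    fix \<alpha> assume "\<alpha> \<in> A"
    then have "rel_of (Sup {\<alpha>}) \<subseteq> ?r" by blast
    then show "\<alpha> \<le> Congruence ?r" by (simp add: less_eq_congruence_def *)
  qed
  then show "rel_of (Sup A) \<subseteq> ?r" by (simp add: less_eq_congruence_def *)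
qed

lemma compact_element_Theta: "compact_element (Theta u v)"
  unfolding compact_element_def Theta_le_iff by (subst rel_of_Sup_finitary) blast

lemma congruence_generated_eq_Sup:
  "congruence_generated X = Sup ((\<lambda>(u, v). Theta u v) ` X)"
proof -
  have "congruence_generated X \<le> \<alpha> \<longleftrightarrow> Sup ((\<lambda>(u, v). Theta u v) ` X) \<le> \<alpha>" for \<alpha>
    by (auto simp: congruence_generated_le_iff Sup_le_iff Theta_le_iff)
  then show ?thesis by (meson order.antisym order_refl)
qed

lemma compact_congruence_iff:
  "compact_element \<alpha> \<longleftrightarrow> (\<exists>X. finite X \<and> \<alpha> = congruence_generated X)"
proof
  assume "compact_element \<alpha>"
  have "\<alpha> = congruence_generated (rel_of \<alpha>)"
    by (metis congruence_generated_le_iff less_eq_congruence_def order.antisym order_refl)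
  then have "\<alpha> = Sup ((\<lambda>(u, v). Theta u v) ` rel_of \<alpha>)"
    by (simp add: congruence_generated_eq_Sup)
  then obtain F where F: "finite F" "F \<subseteq> (\<lambda>(u, v). Theta u v) ` rel_of \<alpha>" "\<alpha> \<le> Sup F"
    using \<open>compact_element \<alpha>\<close> unfolding compact_element_def by (metis order_refl)
  then obtain X where X: "X \<subseteq> rel_of \<alpha>" "finite X" "F = (\<lambda>(u, v). Theta u v) ` X"
    by (meson finite_subset_image)
  then have "\<alpha> \<le> congruence_generated X" "congruence_generated X \<le> \<alpha>"
    using F by (auto simp: congruence_generated_eq_Sup[symmetric] congruence_generated_le_iff)
  with X show "\<exists>X. finite X \<and> \<alpha> = congruence_generated X" by (meson order.antisym)
next
  assume "\<exists>X. finite X \<and> \<alpha> = congruence_generated X"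
  then obtain X where X: "finite X" "\<alpha> = congruence_generated X" by blast
  have "compact_element (Sup ((\<lambda>(u, v). Theta u v) ` X))"
    using X(1) by induction
      (auto simp: compact_element_bot compact_element_sup compact_element_Theta)
  with X show "compact_element \<alpha>" by (simp add: congruence_generated_eq_Sup)
qed

text \<open>The join-semilattice of compact congruences, with the join and order of the congruence
  lattice.\<close>

typedef (overloaded) 'a compact_congruence =
  "{\<alpha> :: 'a::lattice congruence. compact_element \<alpha>}"
  morphisms congruence_of Compact_Congruence
  using compact_element_bot by blast

instantiation compact_congruence :: (lattice) semilattice_sup
begin

definition less_eq_compact_congruence ::
    "'a compact_congruence \<Rightarrow> 'a compact_congruence \<Rightarrow> bool" where
  "\<alpha> \<le> \<beta> \<longleftrightarrow> congruence_of \<alpha> \<le> congruence_of \<beta>"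

definition less_compact_congruence ::
    "'a compact_congruence \<Rightarrow> 'a compact_congruence \<Rightarrow> bool" where
  "\<alpha> < \<beta> \<longleftrightarrow> congruence_of \<alpha> < congruence_of \<beta>"

definition sup_compact_congruence ::
    "'a compact_congruence \<Rightarrow> 'a compact_congruence \<Rightarrow> 'a compact_congruence" where
  "sup \<alpha> \<beta> = Compact_Congruence (sup (congruence_of \<alpha>) (congruence_of \<beta>))"

lemma congruence_of_sup:
  "congruence_of (sup \<alpha> \<beta>) = sup (congruence_of \<alpha>) (congruence_of \<beta>)"
  using congruence_of[of \<alpha>] congruence_of[of \<beta>]
  by (simp add: sup_compact_congruence_def Compact_Congruence_inverse compact_element_sup)

instance
  by standard (auto simp: less_eq_compact_congruence_def less_compact_congruence_def
      congruence_of_sup simp flip: congruence_of_inject)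

end

text \<open>Semilattices are types of class \<^class>\<open>semilattice_sup\<close>. A definition cannot quantify over
  types, so the type \<open>'i\<close> from which the index sets \<open>I\<close> are drawn is a parameter; the index sets
  are arbitrary when \<open>'i\<close> is left arbitrary. Only the values of the families on \<open>I\<close> (resp.
  \<open>I \<times> I\<close>) matter.\<close>

definition uniform_refinement_at :: "'i itself \<Rightarrow> 's::semilattice_sup \<Rightarrow> bool" where
  "uniform_refinement_at (_ :: 'i itself) e \<longleftrightarrow>
     (\<forall>(I :: 'i set) a b. (\<forall>i\<in>I. sup (a i) (b i) = e) \<longrightarrow>
       (\<exists>a' b' c.
          (\<forall>i\<in>I. a' i \<le> a i \<and> b' i \<le> b i \<and> sup (a' i) (b' i) = e) \<and>
          (\<forall>i\<in>I. \<forall>j\<in>I. c i j \<le> a' i \<and> c i j \<le> b' j \<and> a' i \<le> sup (a' j) (c i j)) \<and>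
          (\<forall>i\<in>I. \<forall>j\<in>I. \<forall>k\<in>I. c i k \<le> sup (c i j) (c j k))))"

definition uniform_refinement_property :: "'i itself \<Rightarrow> 's::semilattice_sup itself \<Rightarrow> bool" where
  "uniform_refinement_property (_ :: 'i itself) (_ :: 's itself) \<longleftrightarrow>
     (\<forall>e::'s. uniform_refinement_at TYPE('i) e)"

end

theory Submission
  imports Defs
begin

text \<open>The proof rests on replacing the hypothesis \<open>a\<^sub>i + b\<^sub>i = e\<close> of the Uniform Refinement
  Property by the weaker \<open>e \<le> a\<^sub>i + b\<^sub>i\<close>. The elements \<open>e\<close> with the resulting stronger property
  are closed under joins: refine below \<open>e\<close> and below \<open>f\<close> separately, and join the two
  refinements (\<open>strong_uniform_refinement_at_sup\<close>). As every compact congruence is a finite join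
  of congruences \<open>\<Theta>(u, v)\<close> with \<open>u \<le> v\<close> (\<open>compact_congruence_induct\<close>), only \<open>e = \<Theta>(u, v)\<close> is
  left.

  In that case congruence splitting, applied to \<open>\<Theta>(u, v) \<le> a\<^sub>i + b\<^sub>i\<close>, gives
  \<open>x\<^sub>i, y\<^sub>i \<in> [u, v]\<close> with \<open>x\<^sub>i \<squnion> y\<^sub>i = v\<close>, \<open>\<Theta>(u, x\<^sub>i) \<le> a\<^sub>i\<close> and \<open>\<Theta>(u, y\<^sub>i) \<le> b\<^sub>i\<close>. Hence \<open>x\<^sub>i\<close>
  cuts the interval \<open>[u, v]\<close> into a part \<open>[u, x\<^sub>i]\<close> collapsed by \<open>a\<^sub>i\<close> and a part \<open>[x\<^sub>i, v]\<close>
  collapsed by \<open>b\<^sub>i\<close>, and the refinement is read off from these cuts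
  (\<open>strong_uniform_refinement_at_principal\<close>):
  \<open>a\<^sub>i\<^sup>* = \<Theta>(u, x\<^sub>i)\<close>, \<open>b\<^sub>i\<^sup>* = \<Theta>(x\<^sub>i, v)\<close> and \<open>c\<^sub>i\<^sub>j = \<Theta>(x\<^sub>j, x\<^sub>i \<squnion> x\<^sub>j)\<close>. The last one measures
  the failure of \<open>x\<^sub>i \<le> x\<^sub>j\<close>, which is why it satisfies a triangle inequality.\<close>

lemma congruence_refl: "(x, x) \<in> rel_of \<alpha>"
  and congruence_sym: "(x, y) \<in> rel_of \<alpha> \<Longrightarrow> (y, x) \<in> rel_of \<alpha>"
  and congruence_trans: "(x, y) \<in> rel_of \<alpha> \<Longrightarrow> (y, z) \<in> rel_of \<alpha> \<Longrightarrow> (x, z) \<in> rel_of \<alpha>"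
  and congruence_sup:
    "(x, y) \<in> rel_of \<alpha> \<Longrightarrow> (x', y') \<in> rel_of \<alpha> \<Longrightarrow> (sup x x', sup y y') \<in> rel_of \<alpha>"
  and congruence_inf:
    "(x, y) \<in> rel_of \<alpha> \<Longrightarrow> (x', y') \<in> rel_of \<alpha> \<Longrightarrow> (inf x x', inf y y') \<in> rel_of \<alpha>"
  using lattice_congruence_rel_of[of \<alpha>]
  unfolding lattice_congruence_def equiv_def refl_on_def sym_def trans_def by blast+

lemma congruence_convex:
  assumes "(x, y) \<in> rel_of \<alpha>" "x \<le> z" "z \<le> y"
  shows "(x, z) \<in> rel_of \<alpha>"
  using congruence_inf[OF assms(1) congruence_refl[of z]] assms(2,3)
  by (simp add: inf_absorb1 inf_absorb2)

lemma Theta_inf_sup: "Theta (inf u v) (sup u v) = Theta u v"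
proof -
  have "(inf u v, sup u v) \<in> rel_of \<alpha> \<longleftrightarrow> (u, v) \<in> rel_of \<alpha>" for \<alpha>
  proof
    assume *: "(inf u v, sup u v) \<in> rel_of \<alpha>"
    have "(inf u v, u) \<in> rel_of \<alpha>" "(inf u v, v) \<in> rel_of \<alpha>"
      by (rule congruence_convex[OF *]; simp)+
    then show "(u, v) \<in> rel_of \<alpha>"
      by (meson congruence_sym congruence_trans)
  next
    assume *: "(u, v) \<in> rel_of \<alpha>"
    have "(inf u v, v) \<in> rel_of \<alpha>" "(v, sup u v) \<in> rel_of \<alpha>"
      using congruence_inf[OF * congruence_refl[of v]]
        congruence_sup[OF congruence_sym[OF *] congruence_refl[of v]] by simp_all
    then show "(inf u v, sup u v) \<in> rel_of \<alpha>"
      by (rule congruence_trans)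
  qed
  then have "Theta (inf u v) (sup u v) \<le> \<alpha> \<longleftrightarrow> Theta u v \<le> \<alpha>" for \<alpha>
    by (simp add: Theta_le_iff)
  then show ?thesis by (meson order.antisym order_refl)
qed

definition principal :: "'a::lattice \<Rightarrow> 'a \<Rightarrow> 'a compact_congruence" where
  "principal u v = Compact_Congruence (Theta u v)"

lemma congruence_of_principal: "congruence_of (principal u v) = Theta u v"
  by (simp add: principal_def Compact_Congruence_inverse compact_element_Theta)

lemma principal_le_iff: "principal u v \<le> \<alpha> \<longleftrightarrow> (u, v) \<in> rel_of (congruence_of \<alpha>)"
  by (simp add: less_eq_compact_congruence_def congruence_of_principal Theta_le_iff)

lemma compact_congruence_induct [case_names principal sup]:
  fixes e :: "'a::lattice compact_congruence"
  assumes principal: "\<And>u v. u \<le> v \<Longrightarrow> P (principal u v)"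
    and sup: "\<And>e f. P e \<Longrightarrow> P f \<Longrightarrow> P (sup e f)"
  shows "P e"
proof -
  obtain X where "finite X" "congruence_of e = congruence_generated X"
    using congruence_of[of e] compact_congruence_iff by auto
  then have "congruence_of e = Sup ((\<lambda>(u, v). Theta u v) ` X)"
    by (simp add: congruence_generated_eq_Sup)
  with \<open>finite X\<close> show ?thesis
  proof (induction X arbitrary: e rule: finite_induct)
    case empty
    \<comment> \<open>The empty join is the principal congruence of an arbitrary trivial interval.\<close>
    have "Theta u u = (bot :: 'a congruence)" for u
      by (simp add: Theta_le_iff congruence_refl flip: bot_unique)
    then have "e = principal undefined undefined"
      using empty by (simp add: congruence_of_principal flip: congruence_of_inject)
    then show ?case by (simp add: principal)
  next
    case (insert p X)
    obtain u v where p: "p = (u, v)" by (cases p)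
    have "compact_element (Sup ((\<lambda>(u, v). Theta u v) ` X))"
      using \<open>finite X\<close> compact_congruence_iff congruence_generated_eq_Sup by metis
    then obtain f where f: "congruence_of f = Sup ((\<lambda>(u, v). Theta u v) ` X)"
      using Compact_Congruence_inverse by blast
    have "e = sup (principal (inf u v) (sup u v)) f"
      using insert.prems f p
      by (simp add: congruence_of_sup congruence_of_principal Theta_inf_sup
          flip: congruence_of_inject)
    moreover have "P (principal (inf u v) (sup u v))"
      by (rule principal) (simp add: le_infI1)
    ultimately show ?case
      using sup insert.IH[OF f] by blast
  qed
qed

definition uniform_refinement ::
    "'i set \<Rightarrow> 's::semilattice_sup \<Rightarrow> ('i \<Rightarrow> 's) \<Rightarrow> ('i \<Rightarrow> 's) \<Rightarrow>
      ('i \<Rightarrow> 's) \<Rightarrow> ('i \<Rightarrow> 's) \<Rightarrow> ('i \<Rightarrow> 'i \<Rightarrow> 's) \<Rightarrow> bool" where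
  "uniform_refinement I e a b a' b' c \<longleftrightarrow>
     (\<forall>i\<in>I. a' i \<le> a i \<and> b' i \<le> b i \<and> sup (a' i) (b' i) = e) \<and>
     (\<forall>i\<in>I. \<forall>j\<in>I. c i j \<le> a' i \<and> c i j \<le> b' j \<and> a' i \<le> sup (a' j) (c i j)) \<and>
     (\<forall>i\<in>I. \<forall>j\<in>I. \<forall>k\<in>I. c i k \<le> sup (c i j) (c j k))"

text \<open>In a distributive semilattice this is equivalent to the Uniform Refinement Property at \<open>e\<close>;
  the inequality \<open>e \<le> a\<^sub>i + b\<^sub>i\<close> makes closure under joins hold in every semilattice.\<close>

definition strong_uniform_refinement_at :: "'i itself \<Rightarrow> 's::semilattice_sup \<Rightarrow> bool" where
  "strong_uniform_refinement_at (_ :: 'i itself) e \<longleftrightarrow>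
     (\<forall>(I :: 'i set) a b. (\<forall>i\<in>I. e \<le> sup (a i) (b i)) \<longrightarrow>
       (\<exists>a' b' c. uniform_refinement I e a b a' b' c))"

lemma strong_uniform_refinement_at_imp:
  "strong_uniform_refinement_at TYPE('i) e \<Longrightarrow> uniform_refinement_at TYPE('i) e"
  unfolding strong_uniform_refinement_at_def uniform_refinement_at_def uniform_refinement_def
  by (metis order_refl)

lemma uniform_refinement_sup:
  assumes "uniform_refinement I e a b a1 b1 c1" "uniform_refinement I f a b a2 b2 c2"
  shows "uniform_refinement I (sup e f) a b
    (\<lambda>i. sup (a1 i) (a2 i)) (\<lambda>i. sup (b1 i) (b2 i)) (\<lambda>i j. sup (c1 i j) (c2 i j))"
proof -
  have shuffle: "sup (sup x y) (sup z w) = sup (sup x z) (sup y w)" for x y z w :: 'b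
    by (simp add: ac_simps)
  have join_mono: "sup x y \<le> sup (sup x1 y1) (sup x2 y2)"
    if "x \<le> sup x1 x2" "y \<le> sup y1 y2" for x y x1 x2 y1 y2 :: 'b
    using sup_mono[OF that] by (simp add: shuffle)
  show ?thesis
    unfolding uniform_refinement_def
  proof (intro conjI ballI)
    fix i assume "i \<in> I"
    with assms show "sup (a1 i) (a2 i) \<le> a i" "sup (b1 i) (b2 i) \<le> b i"
      "sup (sup (a1 i) (a2 i)) (sup (b1 i) (b2 i)) = sup e f"
      unfolding uniform_refinement_def shuffle[of "a1 i" "a2 i"] by simp_all
  next
    fix i j assume "i \<in> I" "j \<in> I"
    with assms show "sup (c1 i j) (c2 i j) \<le> sup (a1 i) (a2 i)"
      "sup (c1 i j) (c2 i j) \<le> sup (b1 j) (b2 j)"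
      "sup (a1 i) (a2 i) \<le> sup (sup (a1 j) (a2 j)) (sup (c1 i j) (c2 i j))"
      unfolding uniform_refinement_def by (blast intro: sup_mono join_mono)+
  next
    fix i j k assume "i \<in> I" "j \<in> I" "k \<in> I"
    with assms show "sup (c1 i k) (c2 i k) \<le>
        sup (sup (c1 i j) (c2 i j)) (sup (c1 j k) (c2 j k))"
      unfolding uniform_refinement_def by (blast intro: join_mono)
  qed
qed

lemma strong_uniform_refinement_at_sup:
  assumes "strong_uniform_refinement_at TYPE('i) e" "strong_uniform_refinement_at TYPE('i) f"
  shows "strong_uniform_refinement_at TYPE('i) (sup e f)"
  unfolding strong_uniform_refinement_at_def
proof (intro allI impI)
  fix I :: "'i set" and a b
  assume "\<forall>i\<in>I. sup e f \<le> sup (a i) (b i)"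
  then have "\<forall>i\<in>I. e \<le> sup (a i) (b i)" "\<forall>i\<in>I. f \<le> sup (a i) (b i)"
    by simp_all
  with assms show "\<exists>a' b' c. uniform_refinement I (sup e f) a b a' b' c"
    unfolding strong_uniform_refinement_at_def by (meson uniform_refinement_sup)
qed

text \<open>Splitting produces \<open>x, y \<in> [u, v]\<close> with \<open>x \<squnion> y = v\<close>, where \<open>u \<equiv> x\<close> modulo \<open>\<alpha>\<close> and
  \<open>u \<equiv> y\<close> modulo \<open>\<beta>\<close>. Joining the second congruence with \<open>x\<close> turns it into \<open>x \<equiv> v\<close>, so the
  cut is at \<open>x\<close>.\<close>

lemma congruence_splitting_cut:
  fixes u v :: "'a::lattice"
  assumes "congruence_splitting TYPE('a)" "u \<le> v" "principal u v \<le> sup \<alpha> \<beta>"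
  obtains x where "u \<le> x" "x \<le> v" "principal u x \<le> \<alpha>" "principal x v \<le> \<beta>"
proof -
  have "Theta u v \<le> sup (congruence_of \<alpha>) (congruence_of \<beta>)"
    using assms(3)
    by (simp add: less_eq_compact_congruence_def congruence_of_principal congruence_of_sup)
  with assms(1,2) obtain x y where x: "u \<le> x" "x \<le> v" and y: "u \<le> y" "y \<le> v"
    and xy: "sup x y = v" "Theta u x \<le> congruence_of \<alpha>" "Theta u y \<le> congruence_of \<beta>"
    unfolding congruence_splitting_def by (meson atLeastAtMost_iff)
  have "(sup x u, sup x y) \<in> rel_of (congruence_of \<beta>)"
    using xy(3) by (intro congruence_sup congruence_refl) (simp add: Theta_le_iff)
  then have "principal x v \<le> \<beta>"
    using x(1) xy(1) by (simp add: principal_le_iff sup_absorb1)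
  with x xy(2) that show thesis
    by (simp add: less_eq_compact_congruence_def congruence_of_principal)
qed

lemma principal_trans: "principal x z \<le> sup (principal x y) (principal y z)"
  by (metis congruence_trans principal_le_iff sup_ge1 sup_ge2)

lemma principal_mono:
  assumes "u \<le> x" "x \<le> y" "y \<le> v"
  shows "principal x y \<le> principal u v"
proof -
  have *: "(u, v) \<in> rel_of (congruence_of (principal u v))"
    by (simp flip: principal_le_iff)
  then have "(u, x) \<in> rel_of (congruence_of (principal u v))"
    "(u, y) \<in> rel_of (congruence_of (principal u v))"
    using assms by (auto intro: congruence_convex[OF *])
  then show ?thesis
    unfolding principal_le_iff by (meson congruence_sym congruence_trans)
qed

lemma principal_sup_le: "principal (sup x z) (sup y z) \<le> principal x y"
  by (metis congruence_refl congruence_sup order_refl principal_le_iff)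

text \<open>Modulo the right-hand side, \<open>z \<equiv> y \<squnion> z \<equiv> x \<squnion> y \<squnion> z\<close>, and \<open>x \<squnion> z\<close> lies between the two
  ends of this chain.\<close>

lemma principal_triangle:
  "principal z (sup x z) \<le> sup (principal y (sup x y)) (principal z (sup y z))"
proof -
  have "principal z (sup x z) \<le> principal z (sup (sup x y) z)"
    by (rule principal_mono) (auto intro: le_supI1)
  also have "\<dots> \<le> sup (principal z (sup y z)) (principal (sup y z) (sup (sup x y) z))"
    by (rule principal_trans)
  also have "\<dots> \<le> sup (principal z (sup y z)) (principal y (sup x y))"
    by (intro sup_mono order_refl principal_sup_le)
  finally show ?thesis by (simp add: sup_commute)
qed

lemma uniform_refinement_cuts:
  assumes "\<And>i. i \<in> I \<Longrightarrow> u \<le> x i" "\<And>i. i \<in> I \<Longrightarrow> x i \<le> v"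
    and "\<And>i. i \<in> I \<Longrightarrow> principal u (x i) \<le> a i" "\<And>i. i \<in> I \<Longrightarrow> principal (x i) v \<le> b i"
  shows "uniform_refinement I (principal u v) a b
    (\<lambda>i. principal u (x i)) (\<lambda>i. principal (x i) v) (\<lambda>i j. principal (x j) (sup (x i) (x j)))"
  unfolding uniform_refinement_def
proof (intro conjI ballI)
  fix i assume i: "i \<in> I"
  show "principal u (x i) \<le> a i" "principal (x i) v \<le> b i"
    using i assms by auto
  show "sup (principal u (x i)) (principal (x i) v) = principal u v"
    using i assms(1,2) by (intro order.antisym le_supI principal_mono principal_trans) auto
next
  fix i j assume ij: "i \<in> I" "j \<in> I"
  show "principal (x j) (sup (x i) (x j)) \<le> principal u (x i)"
    using principal_sup_le[of u "x j" "x i"] assms(1)[OF ij(2)] by (simp add: sup_absorb2)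
  show "principal (x j) (sup (x i) (x j)) \<le> principal (x j) v"
    using ij assms(2) by (intro principal_mono) auto
  have "principal u (x i) \<le> principal u (sup (x i) (x j))"
    using ij assms(1) by (intro principal_mono) auto
  also have "\<dots> \<le> sup (principal u (x j)) (principal (x j) (sup (x i) (x j)))"
    by (rule principal_trans)
  finally show "principal u (x i) \<le> \<dots>" .
next
  fix i j k
  show "principal (x k) (sup (x i) (x k)) \<le>
    sup (principal (x j) (sup (x i) (x j))) (principal (x k) (sup (x j) (x k)))"
    by (rule principal_triangle)
qed

lemma strong_uniform_refinement_at_principal:
  fixes u v :: "'a::lattice"
  assumes "congruence_splitting TYPE('a)" "u \<le> v"
  shows "strong_uniform_refinement_at TYPE('i) (principal u v)"
  unfolding strong_uniform_refinement_at_def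
proof (intro allI impI)
  fix I :: "'i set" and a b
  assume "\<forall>i\<in>I. principal u v \<le> sup (a i) (b i)"
  then have "\<forall>i\<in>I. \<exists>x. u \<le> x \<and> x \<le> v \<and> principal u x \<le> a i \<and> principal x v \<le> b i"
    using congruence_splitting_cut[OF assms] by metis
  then obtain x where
    "\<forall>i\<in>I. u \<le> x i \<and> x i \<le> v \<and> principal u (x i) \<le> a i \<and> principal (x i) v \<le> b i"
    by metis
  then show "\<exists>a' b' c. uniform_refinement I (principal u v) a b a' b' c"
    using uniform_refinement_cuts[of I u x v a b] by blast
qed

theorem theorem3p3:
  assumes "congruence_splitting TYPE('a::lattice)"
  shows "uniform_refinement_property TYPE('i) TYPE('a compact_congruence)"
  unfolding uniform_refinement_property_def
proof
  fix e :: "'a compact_congruence"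
  have "strong_uniform_refinement_at TYPE('i) e"
    by (induction e rule: compact_congruence_induct)
      (auto intro: strong_uniform_refinement_at_principal[OF assms] strong_uniform_refinement_at_sup)
  then show "uniform_refinement_at TYPE('i) e"
    by (rule strong_uniform_refinement_at_imp)
qed

end
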